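(* For every integer $d \geq 3$ there exists an infinite, connected, simple $d$-regular graph $G$ that contains a cycle, is not quasi-transitive, and satisfies $p_c(G) = \frac{1}{d-1}$.
   Context: A graph is $d$-regular if every vertex has exactly $d$ neighbours. Let $\mathrm{AUT}(G)$ be the group of all automorphisms of $G$ (adjacency-preserving bijections of the vertex set). $G$ is called quasi-transitive if the action of $\mathrm{AUT}(G)$ on the vertices of $G$ has finitely many orbits. Bernoulli bond percolation with parameter $p \in [0,1]$ on $G$: each edge is retained independently with probability $p$ and deleted with probability $1-p$; $\mathbb{P}_p$ denotes the corresponding probability measure. Let $\psi(p) = \mathbb{P}_p(\text{there exists an infinite connected component of retained edges})$. The critical parameter is $p_c(G) := \sup\{p \in [0,1] : \psi(p) = 0\}$. *)

theory Defs
  imports "HOL-Probability.Probability" "HOL-Algebra.Bij" "HOL-Algebra.Group_Action"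
begin

section \<open>Simple graphs\<close>

text \<open>A graph is a vertex set \<open>V\<close> together with a set \<open>E\<close> of undirected edges, each edge being
  an unordered pair of distinct vertices. Both sets may be infinite.\<close>

definition simple_graph :: "'a set \<Rightarrow> 'a set set \<Rightarrow> bool" where
  "simple_graph V E \<longleftrightarrow> (\<forall>e\<in>E. e \<subseteq> V \<and> card e = 2)"

definition neighbours :: "'a set set \<Rightarrow> 'a \<Rightarrow> 'a set" where
  "neighbours E v = {u. {v, u} \<in> E}"

text \<open>Finiteness is required explicitly because \<open>card\<close> of an infinite set is \<open>0\<close>.\<close>

definition regular_graph :: "nat \<Rightarrow> 'a set \<Rightarrow> 'a set set \<Rightarrow> bool" where
  "regular_graph d V E \<longleftrightarrow> (\<forall>v\<in>V. finite (neighbours E v) \<and> card (neighbours E v) = d)"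

definition adj_rel :: "'a set set \<Rightarrow> ('a \<times> 'a) set" where
  "adj_rel E = {(u, v). {u, v} \<in> E}"

definition component_of :: "'a set \<Rightarrow> 'a set set \<Rightarrow> 'a \<Rightarrow> 'a set" where
  "component_of V E u = {v \<in> V. (u, v) \<in> (adj_rel E)\<^sup>*}"

definition components :: "'a set \<Rightarrow> 'a set set \<Rightarrow> 'a set set" where
  "components V E = component_of V E ` V"

definition connected_graph :: "'a set \<Rightarrow> 'a set set \<Rightarrow> bool" where
  "connected_graph V E \<longleftrightarrow> V \<noteq> {} \<and> (\<forall>u\<in>V. \<forall>v\<in>V. (u, v) \<in> (adj_rel E)\<^sup>*)"

definition is_cycle :: "'a set set \<Rightarrow> 'a list \<Rightarrow> bool" where
  "is_cycle E xs \<longleftrightarrow> length xs \<ge> 3 \<and> distinct xs \<and>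
     (\<forall>i<length xs. {xs ! i, xs ! (Suc i mod length xs)} \<in> E)"

definition contains_cycle :: "'a set set \<Rightarrow> bool" where
  "contains_cycle E \<longleftrightarrow> (\<exists>xs. is_cycle E xs)"


section \<open>Automorphisms and quasi-transitivity\<close>

text \<open>As in \<open>BijGroup\<close>, automorphisms are made extensional (\<open>undefined\<close> outside \<open>V\<close>), so that
  each automorphism has exactly one representative.\<close>

definition graph_aut :: "'a set \<Rightarrow> 'a set set \<Rightarrow> ('a \<Rightarrow> 'a) monoid" where
  "graph_aut V E =
     BijGroup V \<lparr>carrier := {f \<in> Bij V. \<forall>u\<in>V. \<forall>v\<in>V. {f u, f v} \<in> E \<longleftrightarrow> {u, v} \<in> E}\<rparr>"

definition quasi_transitive :: "'a set \<Rightarrow> 'a set set \<Rightarrow> bool" where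
  "quasi_transitive V E \<longleftrightarrow> finite (orbits (graph_aut V E) V (\<lambda>f. f))"

lemma graph_aut_subgroup: "subgroup (carrier (graph_aut V E)) (BijGroup V)"
proof
  show "carrier (graph_aut V E) \<subseteq> carrier (BijGroup V)"
    by (auto simp: graph_aut_def BijGroup_def)
next
  fix f g assume fg: "f \<in> carrier (graph_aut V E)" "g \<in> carrier (graph_aut V E)"
  then have "f \<in> Bij V" "g \<in> Bij V" by (auto simp: graph_aut_def)
  with fg show "f \<otimes>\<^bsub>BijGroup V\<^esub> g \<in> carrier (graph_aut V E)"
    using Bij_imp_funcset[of g V]
    by (auto simp: graph_aut_def BijGroup_def compose_Bij compose_eq Pi_iff)
next
  show "\<one>\<^bsub>BijGroup V\<^esub> \<in> carrier (graph_aut V E)"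
    by (auto simp: graph_aut_def BijGroup_def id_Bij)
next
  fix f assume f: "f \<in> carrier (graph_aut V E)"
  then have B: "f \<in> Bij V" by (auto simp: graph_aut_def)
  then have b: "bij_betw f V V" by (auto simp: Bij_def)
  have i: "inv_into V f u \<in> V" "f (inv_into V f u) = u" if "u \<in> V" for u
    using b that by (auto simp: bij_betw_def inv_into_into f_inv_into_f)
  have "{inv_into V f u, inv_into V f v} \<in> E \<longleftrightarrow> {u, v} \<in> E" if "u \<in> V" "v \<in> V" for u v
  proof -
    have "{f (inv_into V f u), f (inv_into V f v)} \<in> E \<longleftrightarrow> {inv_into V f u, inv_into V f v} \<in> E"
      using f i(1)[OF that(1)] i(1)[OF that(2)] by (simp add: graph_aut_def)
    then show ?thesis using i that by simp
  qed
  then show "inv\<^bsub>BijGroup V\<^esub> f \<in> carrier (graph_aut V E)"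
    using B by (auto simp: graph_aut_def inv_BijGroup restrict_inv_into_Bij)
qed

lemma graph_aut_action: "group_action (graph_aut V E) V (\<lambda>f. f)"
proof -
  have eq: "graph_aut V E = BijGroup V \<lparr>carrier := carrier (graph_aut V E)\<rparr>"
    by (simp add: graph_aut_def)
  have "group (graph_aut V E)"
    by (subst eq) (rule subgroup.subgroup_is_group[OF graph_aut_subgroup group_BijGroup])
  then show ?thesis
    using subgroup.subset[OF graph_aut_subgroup, of V E]
    by (auto simp: group_action_def group_hom_def group_hom_axioms_def group_BijGroup
        hom_def graph_aut_def)
qed


section \<open>Bernoulli bond percolation\<close>

text \<open>A configuration assigns \<open>True\<close> to the retained edges. The product measure makes the states
  of the edges independent.\<close>

definition percolation :: "'a set set \<Rightarrow> real \<Rightarrow> ('a set \<Rightarrow> bool) measure" where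
  "percolation E p = (\<Pi>\<^sub>M e\<in>E. measure_pmf (bernoulli_pmf p))"

definition retained :: "'a set set \<Rightarrow> ('a set \<Rightarrow> bool) \<Rightarrow> 'a set set" where
  "retained E \<omega> = {e \<in> E. \<omega> e}"

definition percolates :: "'a set \<Rightarrow> 'a set set \<Rightarrow> ('a set \<Rightarrow> bool) \<Rightarrow> bool" where
  "percolates V E \<omega> \<longleftrightarrow> (\<exists>C\<in>components V (retained E \<omega>). infinite C)"

definition percolation_prob :: "'a set \<Rightarrow> 'a set set \<Rightarrow> real \<Rightarrow> real" where
  "percolation_prob V E p =
     measure (percolation E p) {\<omega> \<in> space (percolation E p). percolates V E \<omega>}"

definition critical_prob :: "'a set \<Rightarrow> 'a set set \<Rightarrow> real" where
  "critical_prob V E = Sup {p \<in> {0..1}. percolation_prob V E p = 0}"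

lemma prob_space_percolation: "prob_space (percolation E p)"
  unfolding percolation_def by (intro prob_space_PiM prob_space_measure_pmf)

text \<open>The function \<open>measure\<close> is \<open>0\<close> on non-measurable sets. The percolation event is measurable
  whenever \<open>V\<close> is countable, so \<open>percolation_prob\<close> is then a genuine probability.\<close>

lemma percolates_measurable:
  assumes "countable V" "simple_graph V E"
  shows "{\<omega> \<in> space (percolation E p). percolates V E \<omega>} \<in> sets (percolation E p)"
proof -
  let ?M = "percolation E p"
  have edge: "Measurable.pred ?M (\<lambda>\<omega>. (u, v) \<in> adj_rel (retained E \<omega>))" for u v
  proof (cases "{u, v} \<in> E")
    case True
    then have "(\<lambda>\<omega>. \<omega> {u, v}) \<in> measurable ?M (measure_pmf (bernoulli_pmf p))"
      unfolding percolation_def by (rule measurable_component_singleton)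
    then have "Measurable.pred ?M (\<lambda>\<omega>. \<omega> {u, v})"
      by (simp add: measurable_def)
    with True show ?thesis by (simp add: adj_rel_def retained_def)
  next
    case False
    then show ?thesis by (simp add: adj_rel_def retained_def)
  qed
  have in_V: "w \<in> V" if "(w, v) \<in> adj_rel (retained E \<omega>)" for w v \<omega>
    using that assms(2) by (auto simp: adj_rel_def retained_def simple_graph_def)
  have pow: "Measurable.pred ?M (\<lambda>\<omega>. (u, v) \<in> adj_rel (retained E \<omega>) ^^ n)" for u v n
  proof (induction n arbitrary: v)
    case (Suc n)
    have "(\<lambda>\<omega>. (u, v) \<in> adj_rel (retained E \<omega>) ^^ Suc n) =
      (\<lambda>\<omega>. \<exists>w\<in>V. (u, w) \<in> adj_rel (retained E \<omega>) ^^ n \<and> (w, v) \<in> adj_rel (retained E \<omega>))"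
      using in_V by (fastforce simp: relcomp_unfold)
    then show ?case
      using Suc edge assms(1) by simp
  qed simp
  have reach: "Measurable.pred ?M (\<lambda>\<omega>. (u, v) \<in> (adj_rel (retained E \<omega>))\<^sup>*)" for u v
    using pow by (simp add: rtrancl_power)
  have fin: "finite A \<longleftrightarrow> (\<exists>m. \<forall>v\<in>V. v \<in> A \<longrightarrow> to_nat_on V v \<le> m)" if "A \<subseteq> V" for A :: "'a set"
  proof -
    have "inj_on (to_nat_on V) A"
      using inj_on_to_nat_on[OF assms(1)] that by (rule inj_on_subset)
    then have "finite A \<longleftrightarrow> finite (to_nat_on V ` A)"
      by (simp add: finite_image_iff)
    then show ?thesis using that by (auto simp: finite_nat_set_iff_bounded_le)
  qed
  have sub: "component_of V F u \<subseteq> V" for F u by (auto simp: component_of_def)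
  have "percolates V E \<omega> \<longleftrightarrow> (\<exists>u\<in>V. \<forall>m. \<exists>v\<in>V.
      (u, v) \<in> (adj_rel (retained E \<omega>))\<^sup>* \<and> \<not> to_nat_on V v \<le> m)" for \<omega>
    unfolding percolates_def components_def using fin[OF sub]
    by (auto simp: component_of_def)
  then have "percolates V E = (\<lambda>\<omega>. \<exists>u\<in>V. \<forall>m. \<exists>v\<in>V.
      (u, v) \<in> (adj_rel (retained E \<omega>))\<^sup>* \<and> \<not> to_nat_on V v \<le> m)"
    by (rule ext)
  then have "Measurable.pred ?M (percolates V E)"
    using reach assms(1) by simp
  then show ?thesis by (simp add: pred_def)
qed

end

theory Submission
  imports Defs "HOL-Combinatorics.Transposition"
begin

text \<open>
  Write \<open>k = d - 1\<close>. The graph is a triangle with trees attached: it comes from a parent function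
  on the natural numbers which has exactly \<open>k\<close> preimages at every number and a single cycle,
  namely \<open>0 \<mapsto> k \<mapsto> 1 \<mapsto> 0\<close>. Joining every number to its parent gives degree \<open>k + 1\<close>.

  Automorphisms permute the vertices on triangles, and there are only finitely many of these. In an
  infinite connected locally finite graph a finite invariant set forces infinitely many orbits,
  because automorphisms also preserve the balls around that set
  (\<open>not_quasi_transitive_if_finite_invariant\<close>).

  For the critical parameter, the descendants of a vertex \<open>w > k\<close> form a \<open>k\<close>-ary tree, so the
  number of descendants of \<open>w\<close> in generation \<open>n\<close> that an open descending path joins to \<open>w\<close> is a
  branching process with binomial offspring distribution. The probability \<open>s\<close> that generation \<open>n\<close>
  is not empty satisfies \<open>s (n + 1) = 1 - (1 - p * s n) ^ k\<close> with \<open>s 0 = 1\<close>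
  (\<open>prob_survives\<close>). Bernoulli's inequality gives \<open>s n \<le> (k * p) ^ n\<close>, and
  \<open>s n \<ge> 1 - 1 / (k * p)\<close> if \<open>k * p > 1\<close>. As any finite set of vertices has only
  finitely many of these trees attached to it, an infinite open cluster exists if and only if one of the trees contains
  descending open paths of every length (\<open>percolates_if_survives\<close>, \<open>survives_if_percolates\<close>).
  Thus percolation has probability zero for \<open>p < 1 / k\<close> and positive probability for \<open>p > 1 / k\<close>.
\<close>

section \<open>Finite invariant sets and quasi-transitivity\<close>

text \<open>An automorphism that preserves \<open>A\<close> preserves every ball around \<open>A\<close>, so each orbit stays in a
  ball. Finitely many orbits would all lie in one ball, which is finite, although the orbits cover
  \<open>V\<close>.\<close>

lemma not_quasi_transitive_if_finite_invariant:
  assumes simple: "simple_graph V E" and conn: "connected_graph V E" and "infinite V"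
    and locfin: "\<And>v. v \<in> V \<Longrightarrow> finite (neighbours E v)"
    and A: "finite A" "A \<noteq> {}" "A \<subseteq> V"
    and inv: "\<And>f. f \<in> carrier (graph_aut V E) \<Longrightarrow> f ` A \<subseteq> A"
  shows "\<not> quasi_transitive V E"
proof
  assume qt: "quasi_transitive V E"
  \<comment> \<open>\<open>B n\<close> is the ball of radius \<open>n\<close> around \<open>A\<close>.\<close>
  define B where "B = rec_nat A (\<lambda>n S. S \<union> (\<Union>v\<in>S. neighbours E v))"
  have B0: "B 0 = A" and BS: "B (Suc n) = B n \<union> (\<Union>v\<in>B n. neighbours E v)" for n
    by (simp_all add: B_def)
  have nbV: "neighbours E v \<subseteq> V" for v
    using simple by (auto simp: simple_graph_def neighbours_def)
  have BV: "B n \<subseteq> V" for n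
    by (induction n) (use A nbV in \<open>auto simp: B0 BS\<close>)
  have Bfin: "finite (B n)" for n
  proof (induction n)
    case (Suc n)
    then show ?case using BV[of n] locfin by (auto simp: BS)
  qed (simp add: B0 A)
  have Bmono: "mono B"
    by (auto simp: mono_iff_le_Suc BS)
  have Binv: "f v \<in> B n" if f: "f \<in> carrier (graph_aut V E)" and "v \<in> B n" for f v n
    using that(2)
  proof (induction n arbitrary: v)
    case 0
    then show ?case using inv[OF f] by (auto simp: B0)
  next
    case (Suc n)
    show ?case
    proof (cases "v \<in> B n")
      case True
      then show ?thesis using Suc.IH by (auto simp: BS)
    next
      case False
      then obtain u where u: "u \<in> B n" "{u, v} \<in> E"
        using Suc.prems by (auto simp: BS neighbours_def)
      then have "u \<in> V" "v \<in> V" using simple by (auto simp: simple_graph_def)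
      then have "{f u, f v} \<in> E" using f u(2) by (simp add: graph_aut_def)
      then show ?thesis using Suc.IH[OF u(1)] by (auto simp: BS neighbours_def)
    qed
  qed
  obtain a where a: "a \<in> A" using A by auto
  have cover: "\<exists>n. v \<in> B n" if "v \<in> V" for v
  proof -
    have "(a, v) \<in> (adj_rel E)\<^sup>*" using conn a A that by (auto simp: connected_graph_def)
    then show ?thesis
    proof induction
      case base
      then show ?case using a B0 by blast
    next
      case (step y z)
      then obtain n where "y \<in> B n" by blast
      with step(2) have "z \<in> B (Suc n)" by (auto simp: BS adj_rel_def neighbours_def)
      then show ?case by blast
    qed
  qed
  let ?O = "orbits (graph_aut V E) V (\<lambda>f. f)"
  have "\<exists>n. S \<subseteq> B n" if "S \<in> ?O" for S
  proof -
    obtain x where x: "x \<in> V" "S = orbit (graph_aut V E) (\<lambda>f. f) x"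
      using \<open>S \<in> ?O\<close> by (auto simp: orbits_def)
    obtain n where "x \<in> B n" using cover x by blast
    then show ?thesis using x(2) Binv by (auto simp: orbit_def)
  qed
  then obtain N where N: "\<And>S. S \<in> ?O \<Longrightarrow> S \<subseteq> B (N S)" by metis
  have "V \<subseteq> B (Max (N ` ?O))"
  proof
    fix v assume v: "v \<in> V"
    let ?o = "orbit (graph_aut V E) (\<lambda>f. f) v"
    have o: "?o \<in> ?O" using v by (auto simp: orbits_def)
    have "v \<in> ?o" by (rule group_action.orbit_refl[OF graph_aut_action v])
    then have "v \<in> B (N ?o)" using N[OF o] by blast
    moreover have "N ?o \<le> Max (N ` ?O)"
      using qt o by (auto simp: quasi_transitive_def intro!: Max_ge)
    ultimately show "v \<in> B (Max (N ` ?O))"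
      using Bmono by (auto dest: monoD)
  qed
  with Bfin \<open>infinite V\<close> show False using finite_subset by blast
qed

section \<open>Events on disjoint coordinates of a product measure\<close>

text \<open>The coordinates of a product measure are independent, hence so are the restrictions of a random
  point to disjoint sets of coordinates. The locality premise says that an event can be read off from
  its restriction, where all other coordinates are \<open>undefined\<close>.\<close>

lemma PiM_prob_disjoint_coordinates:
  fixes P :: "'j \<Rightarrow> ('i \<Rightarrow> 'b) \<Rightarrow> bool"
  assumes M: "\<And>i. prob_space (M i)" and L: "finite L" "L \<noteq> {}"
    and K: "\<And>j. j \<in> L \<Longrightarrow> K j \<subseteq> I" "disjoint_family_on K L"
    and meas: "\<And>j. j \<in> L \<Longrightarrow> Measurable.pred (PiM (K j) M) (P j)"
    and loc: "\<And>j \<omega>. j \<in> L \<Longrightarrow> P j (restrict \<omega> (K j)) = P j \<omega>"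
  shows "measure (PiM I M) {\<omega> \<in> space (PiM I M). \<forall>j\<in>L. P j \<omega>} =
    (\<Prod>j\<in>L. measure (PiM I M) {\<omega> \<in> space (PiM I M). P j \<omega>})"
proof -
  interpret prob_space "PiM I M" by (intro prob_space_PiM M)
  have I: "indep_vars M (\<lambda>i \<omega>. \<omega> i) I"
  proof (cases "I = {}")
    case False
    have "distr (PiM I M) (PiM I M) (\<lambda>x. \<lambda>i\<in>I. x i) = distr (PiM I M) (PiM I M) (\<lambda>x. x)"
      by (intro distr_cong) (auto simp: space_PiM restrict_def fun_eq_iff PiE_def extensional_def)
    also have "\<dots> = PiM I (\<lambda>i. distr (PiM I M) (M i) (\<lambda>\<omega>. \<omega> i))"
      by (subst distr_id, intro PiM_cong refl distr_PiM_component[symmetric] M)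
    finally show ?thesis
      by (subst indep_vars_iff_distr_eq_PiM') (use False in auto)
  qed (unfold indep_vars_def2 indep_sets_def, simp)
  let ?A = "\<lambda>j. {\<eta> \<in> space (PiM (K j) M). P j \<eta>}"
  have eq: "(\<lambda>\<omega>. restrict (\<lambda>i. \<omega> i) (K j)) -` ?A j \<inter> space (PiM I M) =
      {\<omega> \<in> space (PiM I M). P j \<omega>}" if "j \<in> L" for j
    using K(1)[OF that] loc[OF that] by (auto simp: space_PiM PiE_iff extensional_def)
  have "prob (\<Inter>j\<in>L. (\<lambda>\<omega>. restrict (\<lambda>i. \<omega> i) (K j)) -` ?A j \<inter> space (PiM I M)) =
      (\<Prod>j\<in>L. prob ((\<lambda>\<omega>. restrict (\<lambda>i. \<omega> i) (K j)) -` ?A j \<inter> space (PiM I M)))"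
    by (intro indep_varsD[OF indep_vars_restrict[OF I K]] L order_refl) (use meas in \<open>auto simp: pred_def\<close>)
  also have "(\<Inter>j\<in>L. (\<lambda>\<omega>. restrict (\<lambda>i. \<omega> i) (K j)) -` ?A j \<inter> space (PiM I M)) =
      {\<omega> \<in> space (PiM I M). \<forall>j\<in>L. P j \<omega>}"
    using L(2) by (simp only: eq cong: INF_cong) auto
  finally show ?thesis by (simp only: eq cong: prod.cong)
qed

section \<open>Survival probabilities of the binomial branching process\<close>

text \<open>In a Galton-Watson process with offspring distribution binomial with parameters \<open>k\<close> and \<open>p\<close>,
  generation \<open>n + 1\<close> is empty if and only if each of the \<open>k\<close> potential children is absent or has
  no descendant in its own generation \<open>n\<close>.\<close>

primrec survival_prob :: "nat \<Rightarrow> real \<Rightarrow> nat \<Rightarrow> real" where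
  "survival_prob k p 0 = 1"
| "survival_prob k p (Suc n) = 1 - (1 - p * survival_prob k p n) ^ k"

lemma survival_prob_bounds:
  assumes "0 \<le> p" "p \<le> 1"
  shows "0 \<le> survival_prob k p n \<and> survival_prob k p n \<le> 1"
proof (induction n)
  case (Suc n)
  then have "0 \<le> p * survival_prob k p n" "p * survival_prob k p n \<le> 1"
    using assms by (auto intro: mult_le_one)
  then show ?case by (auto intro: power_le_one)
qed simp

text \<open>This is the first moment bound, as \<open>(k * p) ^ n\<close> is the expected size of generation \<open>n\<close>.\<close>

lemma survival_prob_le:
  assumes "0 \<le> p" "p \<le> 1"
  shows "survival_prob k p n \<le> (real k * p) ^ n"
proof (induction n)
  case (Suc n)
  have b: "p * survival_prob k p n \<le> 1"
    using assms survival_prob_bounds[OF assms] by (auto intro: mult_le_one)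
  have "1 + real k * (- (p * survival_prob k p n)) \<le> (1 + - (p * survival_prob k p n)) ^ k"
    by (rule Bernoulli_inequality) (use b in auto)
  then have "survival_prob k p (Suc n) \<le> (real k * p) * survival_prob k p n"
    by simp
  also have "\<dots> \<le> (real k * p) * (real k * p) ^ n"
    using Suc assms by (intro mult_left_mono) auto
  finally show ?case by simp
qed simp

text \<open>The bound \<open>\<delta> = 1 - 1 / (k * p)\<close> is preserved by the recursion: for \<open>x = p * \<delta>\<close> one has
  \<open>(1 - x) ^ k \<le> 1 / (1 + x) ^ k \<le> 1 / (1 + k * x)\<close>, and \<open>\<delta>\<close> is chosen such that
  \<open>1 + k * x = k * p\<close>.\<close>

lemma survival_prob_ge:
  assumes p: "0 \<le> p" "p \<le> 1" and super: "real k * p > 1"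
  shows "survival_prob k p n \<ge> 1 - 1 / (real k * p)"
proof (induction n)
  case 0
  then show ?case using super by simp
next
  case (Suc n)
  define \<delta> where "\<delta> = 1 - 1 / (real k * p)"
  define x where "x = p * \<delta>"
  have \<delta>: "0 < \<delta>" "\<delta> \<le> 1" using super by (auto simp: \<delta>_def field_simps)
  have x: "0 \<le> x" "x \<le> 1" using \<delta> p by (auto simp: x_def intro: mult_le_one)
  have "k \<noteq> 0" "p \<noteq> 0" using super by - (rule notI, simp)+
  then have kx: "real k * x = real k * p - 1" by (simp add: x_def \<delta>_def field_simps)
  have "(1 - x) ^ k * (real k * p) \<le> (1 - x) ^ k * (1 + x) ^ k"
    using Bernoulli_inequality[of x k] kx x by (intro mult_left_mono) auto
  also have "\<dots> = (1 - x\<^sup>2) ^ k"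
    by (simp add: power_mult_distrib[symmetric] power2_eq_square algebra_simps)
  also have "\<dots> \<le> 1"
    using x by (intro power_le_one) (auto simp: power_le_one)
  finally have "(1 - x) ^ k \<le> 1 / (real k * p)"
    using super by (simp add: field_simps)
  moreover have "(1 - p * survival_prob k p n) ^ k \<le> (1 - x) ^ k"
  proof (rule power_mono)
    show "1 - p * survival_prob k p n \<le> 1 - x"
      using Suc p by (auto simp: x_def \<delta>_def intro: mult_left_mono)
    show "0 \<le> 1 - p * survival_prob k p n"
      using survival_prob_bounds[OF p] p by (auto intro: mult_le_one)
  qed
  ultimately show ?case by simp
qed

section \<open>The graph\<close>

locale unicyclic =
  fixes k :: nat
  assumes k2: "k \<ge> 2"
begin

text \<open>The function \<open>n \<mapsto> n div k\<close> has \<open>k\<close> preimages everywhere and describes the \<open>k\<close>-ary tree with root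
  \<open>0\<close>, except that the root is its own parent. Exchanging the values at \<open>0\<close> and at its descendant
  \<open>k\<^sup>2\<close> keeps the number of preimages and turns \<open>k\<^sup>2 \<mapsto> k \<mapsto> 1 \<mapsto> 0 \<mapsto> 0\<close> into
  \<open>k\<^sup>2 \<mapsto> 0 \<mapsto> k \<mapsto> 1 \<mapsto> 0\<close>: the loop becomes a triangle.\<close>

abbreviation root_swap :: "nat \<Rightarrow> nat" where
  "root_swap \<equiv> Transposition.transpose 0 (k\<^sup>2)"

definition par :: "nat \<Rightarrow> nat" where
  "par n = root_swap n div k"

definition children :: "nat \<Rightarrow> nat set" where
  "children v = {u. par u = v}"

definition edge :: "nat \<Rightarrow> nat set" where
  "edge u = {u, par u}"

definition E :: "nat set set" where
  "E = range edge"

lemma k_less_square: "k < k\<^sup>2" using k2 by (simp add: power2_eq_square)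

lemma par_0: "par 0 = k"
  using k2 by (simp add: par_def power2_eq_square)

lemma par_square: "par (k\<^sup>2) = 0"
  by (simp add: par_def)

lemma par_other: "n \<noteq> 0 \<Longrightarrow> n \<noteq> k\<^sup>2 \<Longrightarrow> par n = n div k"
  by (simp add: par_def)

lemma par_less: "n > 0 \<Longrightarrow> par n < n"
  using k2 by (cases "n = k\<^sup>2") (auto simp: par_square par_other)

lemma par_le: "n \<le> m \<Longrightarrow> k \<le> m \<Longrightarrow> par n \<le> m"
  using par_less[of n] par_0 by (cases "n = 0") auto

lemma funpow_par_le: "n \<le> m \<Longrightarrow> k \<le> m \<Longrightarrow> (par ^^ j) n \<le> m"
  by (induction j) (auto intro: par_le)

text \<open>Above \<open>k\<close> the parent function decreases, and from below it never climbs over \<open>k\<close>, since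
  \<open>par 0 = k\<close> is its only increase. So no vertex above \<open>k\<close> lies on a cycle of \<open>par\<close>.\<close>

lemma funpow_par_less:
  assumes "k < m"
  shows "(par ^^ Suc j) m < m"
proof -
  have "(par ^^ j) (par m) \<le> m - 1"
    using par_less[of m] assms by (intro funpow_par_le) auto
  then show ?thesis using assms by (simp add: funpow_swap1)
qed

lemma par_neq: "par v \<noteq> v"
  using par_less[of v] par_0 k2 by (cases "v = 0") auto

text \<open>Without cycles of length two, different vertices are joined to their parents by different edges,
  and the parent of a vertex is never also one of its children.\<close>

lemma par_par_neq: "par (par v) \<noteq> v"
proof -
  have 1: "par 1 = 0" and 2: "par k = 1" using k2 k_less_square by (auto simp: par_other)
  consider "v > k" | "v = 0" | "v = k" | "0 < v" "v < k" by linarith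
  then show ?thesis
  proof cases
    case 1
    then show ?thesis using funpow_par_less[of v 1] by simp
  next
    case 4
    then have "par v = 0" using k_less_square by (simp add: par_other)
    then show ?thesis using 4 par_0 by simp
  qed (use k2 1 2 par_0 in auto)
qed

lemma card_children: "finite (children v)" "card (children v) = k"
proof -
  have "children v = root_swap ` {u. u div k = v}"
  proof (intro equalityI subsetI)
    fix u assume "u \<in> children v"
    then have "u = root_swap (root_swap u)" "root_swap u div k = v"
      by (simp_all add: children_def par_def)
    then show "u \<in> root_swap ` {u. u div k = v}" by blast
  qed (auto simp: children_def par_def)
  also have "{u. u div k = v} = {k * v..<k * v + k}"
  proof (intro equalityI subsetI)
    fix u assume "u \<in> {u. u div k = v}"
    then have "u = k * v + u mod k" "u mod k < k"
      using k2 by (auto simp: mult.commute)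
    then show "u \<in> {k * v..<k * v + k}" by simp
  qed (use k2 in \<open>auto simp: div_nat_eqI\<close>)
  finally have eq: "children v = root_swap ` {k * v..<k * v + k}" .
  show "finite (children v)" by (simp add: eq)
  show "card (children v) = k" unfolding eq by (subst card_image) auto
qed

lemma children_gt:
  assumes "u \<in> children v" "k < v"
  shows "v < u"
proof -
  have "u > 0" using assms par_0 by (cases "u = 0") (auto simp: children_def)
  then show ?thesis using assms par_less[of u] by (auto simp: children_def)
qed

lemma children_gt_k: "u \<in> children v \<Longrightarrow> k < v \<Longrightarrow> k < u"
  using children_gt by force

lemma edge_in_E: "edge u \<in> E" by (simp add: E_def)

lemma pair_in_E: "{u, v} \<in> E \<longleftrightarrow> par u = v \<or> par v = u"
  by (auto simp: E_def edge_def doubleton_eq_iff)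

lemma inj_edge: "inj edge"
proof (rule injI)
  fix u v assume "edge u = edge v"
  then have "u = v \<or> u = par v \<and> par u = v" by (auto simp: edge_def doubleton_eq_iff)
  then show "u = v" using par_par_neq[of v] by auto
qed

lemma simple: "simple_graph UNIV E"
  using par_neq by (auto simp: simple_graph_def E_def edge_def card_2_iff)

lemma neighbours_eq: "neighbours E v = insert (par v) (children v)"
  by (auto simp: neighbours_def pair_in_E children_def)

lemma regular: "regular_graph (Suc k) UNIV E"
proof -
  have "par v \<notin> children v" for v using par_par_neq by (simp add: children_def)
  then show ?thesis by (auto simp: regular_graph_def neighbours_eq card_children)
qed

lemma connected: "connected_graph UNIV E"
proof -
  have 1: "(v, 0) \<in> (adj_rel E)\<^sup>*" for v
  proof (induction v rule: less_induct)
    case (less v)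
    have "(v, par v) \<in> adj_rel E" by (simp add: adj_rel_def pair_in_E)
    then show ?case
      using less[OF par_less] by (cases "v = 0") (auto intro: converse_rtrancl_into_rtrancl)
  qed
  have "sym (adj_rel E)" by (auto simp: sym_def adj_rel_def insert_commute)
  then have "(0, v) \<in> (adj_rel E)\<^sup>*" for v using 1 sym_rtrancl by (meson symD)
  with 1 show ?thesis by (auto simp: connected_graph_def intro: rtrancl_trans)
qed

lemma cycle: "is_cycle E [0, k, 1]"
  using k2 k_less_square par_0 by (auto simp: is_cycle_def pair_in_E par_other less_Suc_eq nth_Cons')

definition on_triangle :: "nat \<Rightarrow> bool" where
  "on_triangle v \<longleftrightarrow> (\<exists>x y. {v, x} \<in> E \<and> {x, y} \<in> E \<and> {y, v} \<in> E)"

text \<open>The largest vertex of a triangle has two smaller neighbours, whereas a vertex above \<open>k\<close> has only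
  one, its parent.\<close>

lemma on_triangle_le:
  assumes "on_triangle v"
  shows "v \<le> k"
proof -
  have top: "m \<le> k" if "{a, m} \<in> E" "{b, m} \<in> E" "a < m" "b < m" "a \<noteq> b" for a b m
  proof (rule ccontr)
    assume "\<not> m \<le> k"
    then have "c = par m" if "{c, m} \<in> E" "c < m" for c
      using that par_le[of c "m - 1"] by (fastforce simp: pair_in_E)
    then show False using that by metis
  qed
  obtain x y where e: "{v, x} \<in> E" "{x, y} \<in> E" "{y, v} \<in> E"
    using assms by (auto simp: on_triangle_def)
  have ne: "v \<noteq> x" "x \<noteq> y" "y \<noteq> v" using e par_neq by (auto simp: pair_in_E)
  have e': "{x, v} \<in> E" "{y, x} \<in> E" "{v, y} \<in> E" using e by (auto simp: insert_commute)
  consider "x < v" "y < v" | "v < x" "y < x" | "v < y" "x < y" using ne by linarith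
  then show ?thesis
  proof cases
    case 1 then show ?thesis using top[of x v y] e e' ne by auto
  next
    case 2 then show ?thesis using top[of v x y] e e' ne by auto
  next
    case 3 then show ?thesis using top[of v y x] e e' ne by auto
  qed
qed

lemma not_quasi_transitive: "\<not> quasi_transitive UNIV E"
proof (rule not_quasi_transitive_if_finite_invariant[OF simple connected])
  show "finite (neighbours E v)" for v by (simp add: neighbours_eq card_children)
  show "finite {v. on_triangle v}"
    by (rule finite_subset[of _ "{..k}"]) (auto dest: on_triangle_le)
  have "{0, k} \<in> E" "{k, 1} \<in> E" "{1, 0} \<in> E"
    using k2 k_less_square par_0 by (auto simp: pair_in_E par_other)
  then show "{v. on_triangle v} \<noteq> {}" by (auto simp: on_triangle_def)
  show "f ` {v. on_triangle v} \<subseteq> {v. on_triangle v}" if "f \<in> carrier (graph_aut UNIV E)" for f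
  proof -
    have f: "{f u, f v} \<in> E" if "{u, v} \<in> E" for u v
      using that \<open>f \<in> _\<close> by (simp add: graph_aut_def)
    show ?thesis using f by (auto simp: on_triangle_def; blast)
  qed
qed auto

section \<open>Descending open paths\<close>

primrec survives :: "nat \<Rightarrow> nat \<Rightarrow> (nat set \<Rightarrow> bool) \<Rightarrow> bool" where
  "survives 0 w \<omega> \<longleftrightarrow> True"
| "survives (Suc n) w \<omega> \<longleftrightarrow> (\<exists>c\<in>children w. \<omega> (edge c) \<and> survives n c \<omega>)"

lemma survives_mono: "survives (Suc n) w \<omega> \<Longrightarrow> survives n w \<omega>"
  by (induction n arbitrary: w) auto

text \<open>Labels increase along descending paths above \<open>k\<close>, so long paths reach large labels and the
  cluster of \<open>w\<close> is unbounded.\<close>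

lemma percolates_if_survives:
  assumes "k < w" "\<And>n. survives n w \<omega>"
  shows "percolates UNIV E \<omega>"
proof -
  let ?R = "(adj_rel (retained E \<omega>))\<^sup>*"
  have path: "\<exists>u \<ge> w + n. (w, u) \<in> ?R" if "survives n w \<omega>" "k < w" for n w
    using that
  proof (induction n arbitrary: w)
    case (Suc n)
    then obtain c where c: "c \<in> children w" "\<omega> (edge c)" "survives n c \<omega>" by auto
    then obtain u where u: "u \<ge> c + n" "(c, u) \<in> ?R"
      using Suc children_gt_k by blast
    have "(w, c) \<in> adj_rel (retained E \<omega>)"
      using c by (auto simp: adj_rel_def retained_def pair_in_E children_def edge_def insert_commute)
    then have "(w, u) \<in> ?R" using u by (simp add: converse_rtrancl_into_rtrancl)
    moreover have "w < c" using children_gt c Suc by blast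
    ultimately show ?case using u by (intro exI[of _ u]) auto
  qed auto
  let ?C = "component_of UNIV (retained E \<omega>) w"
  have "infinite ?C"
  proof
    assume "finite ?C"
    then obtain m where "\<And>u. u \<in> ?C \<Longrightarrow> u \<le> m" by (auto simp: finite_nat_set_iff_bounded_le)
    moreover obtain u where "u \<ge> w + m" "(w, u) \<in> ?R" using path assms by blast
    ultimately show False using assms(1) by (fastforce simp: component_of_def)
  qed
  then show ?thesis by (auto simp: percolates_def components_def)
qed

definition open_descendants :: "(nat set \<Rightarrow> bool) \<Rightarrow> nat \<Rightarrow> nat set" where
  "open_descendants \<omega> w = {u. (w, u) \<in> {(x, y). y \<in> children x \<and> \<omega> (edge y)}\<^sup>*}"

lemma finite_open_descendants:
  "\<not> survives n w \<omega> \<Longrightarrow> finite (open_descendants \<omega> w)"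
proof (induction n arbitrary: w)
  case (Suc n)
  have "open_descendants \<omega> w \<subseteq>
      insert w (\<Union>c\<in>{c \<in> children w. \<omega> (edge c)}. open_descendants \<omega> c)"
    by (auto simp: open_descendants_def elim: converse_rtranclE)
  moreover have "finite (\<Union>c\<in>{c \<in> children w. \<omega> (edge c)}. open_descendants \<omega> c)"
    using Suc card_children by auto
  ultimately show ?case by (meson finite_insert finite_subset)
qed simp

text \<open>The vertices up to \<open>m\<close>, together with the open descendants of those vertices above \<open>m\<close> whose
  parent is at most \<open>m\<close>, form a set \<open>U\<close> that no open edge leaves. There are finitely many such
  starting vertices, so if all their open descending clusters are finite, then every open cluster
  that meets \<open>{..m}\<close> is finite.\<close>

lemma survives_if_percolates:
  assumes "percolates UNIV E \<omega>"
  shows "\<exists>w>k. \<forall>n. survives n w \<omega>"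
proof (rule ccontr)
  assume "\<not> ?thesis"
  then have fin: "finite (open_descendants \<omega> w)" if "k < w" for w
    using that finite_open_descendants by blast
  obtain v where v: "infinite (component_of UNIV (retained E \<omega>) v)"
    using assms by (auto simp: percolates_def components_def)
  define m where "m = max k v"
  define W where "W = {w. m < w \<and> par w \<le> m}"
  define U where "U = {..m} \<union> (\<Union>w\<in>W. open_descendants \<omega> w)"
  have "W \<subseteq> (\<Union>x\<in>{..m}. children x)" by (auto simp: W_def children_def)
  then have "finite W" by (rule finite_subset) (auto simp: card_children)
  then have "finite U" using fin by (auto simp: U_def W_def m_def)
  have "u \<in> U" if "(v, u) \<in> (adj_rel (retained E \<omega>))\<^sup>*" for u
    using that
  proof induction
    case base
    then show ?case by (auto simp: U_def m_def)
  next
    case (step x y)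
    have xy: "\<omega> {x, y}" "par x = y \<or> par y = x"
      using step(2) by (auto simp: adj_rel_def retained_def pair_in_E)
    consider "x \<le> m" | w where "w \<in> W" "x \<in> open_descendants \<omega> w"
      using step.IH by (auto simp: U_def)
    then show ?case
    proof cases
      case 1
      show ?thesis
      proof (cases "y \<le> m")
        case False
        then have "par y = x" using 1 xy par_le[of x m] by (auto simp: m_def)
        then have "y \<in> W" using 1 False by (auto simp: W_def)
        then show ?thesis by (auto simp: U_def open_descendants_def)
      qed (simp add: U_def)
    next
      case (2 w)
      show ?thesis
      proof (cases "par y = x")
        case True
        then have "y \<in> open_descendants \<omega> w"
          using 2(2) xy by (auto simp: open_descendants_def children_def edge_def insert_commute
              intro: rtrancl_into_rtrancl)
        then show ?thesis using 2 by (auto simp: U_def)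
      next
        case False
        then have y: "y = par x" using xy by simp
        from 2(2) have "x = w \<or> par x \<in> open_descendants \<omega> w"
          unfolding open_descendants_def by (auto simp: children_def elim: rtranclE)
        then show ?thesis using 2(1) y by (auto simp: U_def W_def)
      qed
    qed
  qed
  then have "component_of UNIV (retained E \<omega>) v \<subseteq> U" by (auto simp: component_of_def)
  then show False using v \<open>finite U\<close> finite_subset by blast
qed

section \<open>The probability of survival\<close>

definition below :: "nat \<Rightarrow> nat set" where
  "below v = {u. \<exists>j. (par ^^ Suc j) u = v}"

definition branch :: "nat \<Rightarrow> nat set" where
  "branch v = {u. \<exists>j. (par ^^ j) u = v}"

lemma branch_eq: "branch v = insert v (below v)"
proof -
  have "(\<exists>j. (par ^^ j) u = v) \<longleftrightarrow> u = v \<or> (\<exists>j. (par ^^ Suc j) u = v)" for u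
    by (metis funpow_0 not0_implies_Suc)
  then show ?thesis by (auto simp: branch_def below_def)
qed

lemma branch_child_subset: "c \<in> children v \<Longrightarrow> branch c \<subseteq> below v"
  by (fastforce simp: branch_def below_def children_def)

lemma not_below_self: "k < v \<Longrightarrow> v \<notin> below v"
proof
  assume "k < v" "v \<in> below v"
  then obtain j where "(par ^^ Suc j) v = v" unfolding below_def by blast
  with funpow_par_less[OF \<open>k < v\<close>, of j] show False by simp
qed

text \<open>If some \<open>u\<close> lay below two children of \<open>v\<close>, one child would be an ancestor of the other, and then
  \<open>v\<close> would be its own ancestor, which is impossible above \<open>k\<close>.\<close>

lemma disjoint_branches:
  assumes "k < v"
  shows "disjoint_family_on branch (children v)"
proof -
  have *: "c = c'" if c: "par c = v" "par c' = v" "(par ^^ i) u = c" "(par ^^ (i + j)) u = c'"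
    for c c' i j u
  proof (cases j)
    case (Suc j')
    have "(par ^^ (i + j)) u = (par ^^ j) c" by (simp add: c(3)[symmetric] add.commute[of i] funpow_add)
    then have "(par ^^ j) c = c'" using c(4) by simp
    then have "(par ^^ Suc j) c = v" using c(2) by simp
    then have "(par ^^ j) v = v" using c(1) by (simp add: funpow_swap1)
    then show ?thesis using funpow_par_less[OF assms, of j'] Suc by simp
  qed (use c in simp)
  show ?thesis
    unfolding disjoint_family_on_def
  proof (intro ballI impI)
    fix c c' assume cc: "c \<in> children v" "c' \<in> children v" "c \<noteq> c'"
    show "branch c \<inter> branch c' = {}"
    proof (rule ccontr)
      assume "branch c \<inter> branch c' \<noteq> {}"
      then obtain u i j where ij: "(par ^^ i) u = c" "(par ^^ j) u = c'"
        by (auto simp: branch_def)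
      show False
      proof (cases "i \<le> j")
        case True
        then show ?thesis using *[of c c' i u "j - i"] cc ij by (auto simp: children_def)
      next
        case False
        then show ?thesis using *[of c' c j u "i - j"] cc ij by (auto simp: children_def)
      qed
    qed
  qed
qed

abbreviation bernoulli :: "real \<Rightarrow> nat set \<Rightarrow> bool measure" where
  "bernoulli p \<equiv> (\<lambda>_. measure_pmf (bernoulli_pmf p))"

lemma survives_local:
  "edge ` below w \<subseteq> K \<Longrightarrow> survives n w (restrict \<omega> K) = survives n w \<omega>"
proof (induction n arbitrary: w)
  case (Suc n)
  have "restrict \<omega> K (edge c) = \<omega> (edge c) \<and> survives n c (restrict \<omega> K) = survives n c \<omega>"
    if "c \<in> children w" for c
  proof -
    have "edge c \<in> K" "edge ` below c \<subseteq> K"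
      using Suc.prems branch_child_subset[OF that] by (auto simp: branch_eq)
    then show ?thesis by (intro conjI Suc.IH) auto
  qed
  then show ?case unfolding survives.simps by blast
qed simp

lemma open_measurable:
  "e \<in> K \<Longrightarrow> Measurable.pred (PiM K (bernoulli p)) (\<lambda>\<omega>. \<omega> e)"
  using measurable_component_singleton[of e K "bernoulli p"] by (simp add: measurable_def)

lemma survives_measurable:
  "edge ` below w \<subseteq> K \<Longrightarrow> Measurable.pred (PiM K (bernoulli p)) (survives n w)"
proof (induction n arbitrary: w)
  case (Suc n)
  have "Measurable.pred (PiM K (bernoulli p)) (\<lambda>\<omega>. \<omega> (edge c) \<and> survives n c \<omega>)"
    if "c \<in> children w" for c
  proof -
    have "edge c \<in> K" "edge ` below c \<subseteq> K"
      using Suc.prems branch_child_subset[OF that] by (auto simp: branch_eq)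
    then show ?thesis using Suc.IH[of c] open_measurable by (intro pred_intros_logic) auto
  qed
  then show ?case unfolding survives.simps
    by (intro pred_intros_finite card_children) auto
qed (simp add: survives.simps(1)[abs_def])

lemma prob_open:
  assumes "0 \<le> p" "p \<le> 1" "e \<in> E"
  shows "measure (percolation E p) {\<omega> \<in> space (percolation E p). \<omega> e} = p"
proof -
  have "measure (distr (percolation E p) (measure_pmf (bernoulli_pmf p)) (\<lambda>\<omega>. \<omega> e)) {True} = p"
    unfolding percolation_def using assms
    by (subst distr_PiM_component)
      (auto simp: prob_space_measure_pmf measure_pmf_single)
  moreover have "(\<lambda>\<omega>. \<omega> e) \<in> measurable (percolation E p) (measure_pmf (bernoulli_pmf p))"
    unfolding percolation_def using assms by (intro measurable_component_singleton)
  ultimately show ?thesis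
    by (subst (asm) measure_distr) (auto simp: vimage_def Int_def conj_commute)
qed

text \<open>The edges of the branches at different children of \<open>w\<close> are disjoint, and within one branch the
  edge from \<open>w\<close> to the child is distinct from the edges below the child. Independence for these two
  decompositions is exactly the recursion of \<open>survival_prob\<close>.\<close>

lemma prob_survives:
  assumes p: "0 \<le> p" "p \<le> 1" and "k < w"
  shows "measure (percolation E p) {\<omega> \<in> space (percolation E p). survives n w \<omega>} =
    survival_prob k p n"
  using \<open>k < w\<close>
proof (induction n arbitrary: w)
  case 0
  then show ?case using prob_space.prob_space[OF prob_space_percolation] by simp
next
  case (Suc n)
  interpret prob_space "percolation E p" by (rule prob_space_percolation)
  let ?S = "space (percolation E p)"
  have sub: "edge ` A \<subseteq> E" for A by (auto simp: E_def)
  have meas_E: "{\<omega> \<in> ?S. survives n c \<omega>} \<in> events" "{\<omega> \<in> ?S. \<omega> (edge c)} \<in> events" for n c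
    using survives_measurable[of c E n p] open_measurable[OF edge_in_E, of c p] sub[of "below c"]
    by (auto simp: percolation_def pred_def)
  have ps: "\<And>e. prob_space (bernoulli p e)" by (rule prob_space_measure_pmf)
  have child: "prob {\<omega> \<in> ?S. \<not> (\<omega> (edge c) \<and> survives n c \<omega>)} = 1 - p * survival_prob k p n"
    if c: "c \<in> children w" for c
  proof -
    have gt: "k < c" using children_gt_k c Suc by blast
    let ?P = "\<lambda>b. if b then (\<lambda>\<omega>. \<omega> (edge c)) else survives n c"
    let ?K = "\<lambda>b. if b then {edge c} else edge ` below c"
    have "prob {\<omega> \<in> ?S. \<forall>b\<in>UNIV. ?P b \<omega>} = (\<Prod>b\<in>UNIV. prob {\<omega> \<in> ?S. ?P b \<omega>})"
      unfolding percolation_def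
    proof (rule PiM_prob_disjoint_coordinates[OF ps, where K = ?K])
      show "?K b \<subseteq> E" for b using sub edge_in_E by auto
      show "disjoint_family_on ?K UNIV"
        using not_below_self[OF gt] inj_edge by (auto simp: disjoint_family_on_def dest: injD)
      show "Measurable.pred (PiM (?K b) (bernoulli p)) (?P b)" for b
        using open_measurable[of "edge c" "{edge c}" p] survives_measurable[of c "edge ` below c" n p]
        by auto
      show "?P b (restrict \<omega> (?K b)) = ?P b \<omega>" for b \<omega>
        by (auto simp: survives_local)
    qed auto
    moreover have "(\<forall>b\<in>UNIV. ?P b \<omega>) \<longleftrightarrow> \<omega> (edge c) \<and> survives n c \<omega>" for \<omega>
      unfolding UNIV_bool by auto
    ultimately have "prob {\<omega> \<in> ?S. \<omega> (edge c) \<and> survives n c \<omega>} = p * survival_prob k p n"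
      using prob_open[OF p edge_in_E] Suc.IH[OF gt] by (simp only:) (simp add: UNIV_bool)
    moreover have "{\<omega> \<in> ?S. \<omega> (edge c) \<and> survives n c \<omega>} \<in> events"
      using sets.Int[OF meas_E(1)[of n c] meas_E(2)[of c]]
      by (auto simp: Int_def conj_commute conj_left_commute)
    ultimately show ?thesis by (simp only: prob_neg)
  qed
  have "prob {\<omega> \<in> ?S. \<forall>c\<in>children w. \<not> (\<omega> (edge c) \<and> survives n c \<omega>)} =
      (\<Prod>c\<in>children w. prob {\<omega> \<in> ?S. \<not> (\<omega> (edge c) \<and> survives n c \<omega>)})"
    unfolding percolation_def
  proof (rule PiM_prob_disjoint_coordinates[OF ps, where K = "\<lambda>c. edge ` branch c"])
    show "finite (children w)" by (rule card_children)
    show "children w \<noteq> {}" using card_children(2)[of w] k2 by auto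
    show "edge ` branch c \<subseteq> E" for c by (rule sub)
    show "disjoint_family_on (\<lambda>c. edge ` branch c) (children w)"
      using disjoint_branches[OF \<open>k < w\<close>]
      by (simp add: disjoint_family_on_def image_Int[OF inj_edge, symmetric])
    show "Measurable.pred (PiM (edge ` branch c) (bernoulli p))
        (\<lambda>\<omega>. \<not> (\<omega> (edge c) \<and> survives n c \<omega>))" for c
      by (intro pred_intros_logic survives_measurable open_measurable) (auto simp: branch_eq)
    show "(\<not> (restrict \<omega> (edge ` branch c) (edge c) \<and> survives n c (restrict \<omega> (edge ` branch c))))
        = (\<not> (\<omega> (edge c) \<and> survives n c \<omega>))" for c \<omega>
      by (subst survives_local) (auto simp: branch_eq)
  qed
  also have "\<dots> = (1 - p * survival_prob k p n) ^ k"
    by (simp only: child prod_constant card_children cong: prod.cong)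
  finally have "prob {\<omega> \<in> ?S. \<not> survives (Suc n) w \<omega>} = (1 - p * survival_prob k p n) ^ k"
    by simp
  then show ?case
    using prob_neg[OF meas_E(1)[of "Suc n" w]] by simp
qed

section \<open>The critical parameter\<close>

lemma survives_event:
  "{\<omega> \<in> space (percolation E p). survives n w \<omega>} \<in> sets (percolation E p)"
proof -
  have "edge ` below w \<subseteq> E" by (auto simp: E_def)
  then show ?thesis
    using survives_measurable[of w E n p] by (simp add: percolation_def pred_def)
qed

lemma subcritical:
  assumes p: "0 \<le> p" "p \<le> 1" and sub: "real k * p < 1"
  shows "percolation_prob UNIV E p = 0"
proof -
  interpret prob_space "percolation E p" by (rule prob_space_percolation)
  have "AE \<omega> in percolation E p. k < w \<longrightarrow> \<not> (\<forall>n. survives n w \<omega>)" for w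
  proof (cases "k < w")
    case True
    let ?W = "{\<omega> \<in> space (percolation E p). \<forall>n. survives n w \<omega>}"
    have W: "?W \<in> events"
      using survives_event by (intro sets.sets_Collect_countable_All) auto
    have "prob ?W \<le> (real k * p) ^ n" for n
    proof -
      have "prob ?W \<le> prob {\<omega> \<in> space (percolation E p). survives n w \<omega>}"
        by (intro finite_measure_mono survives_event) auto
      also have "\<dots> \<le> (real k * p) ^ n"
        using prob_survives[OF p True] survival_prob_le[OF p] by simp
      finally show ?thesis .
    qed
    moreover have "(\<lambda>n. (real k * p) ^ n) \<longlonglongrightarrow> 0"
      using p sub by (intro LIMSEQ_power_zero) auto
    ultimately have "prob ?W \<le> 0" by (intro LIMSEQ_le_const) auto
    then have "prob ?W = 0" by (simp add: measure_le_0_iff)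
    then show ?thesis using prob_eq_0[OF W] by auto
  qed simp
  then have "AE \<omega> in percolation E p. \<forall>w. k < w \<longrightarrow> \<not> (\<forall>n. survives n w \<omega>)"
    by (simp add: AE_all_countable)
  then have "AE \<omega> in percolation E p. \<not> percolates UNIV E \<omega>"
    by eventually_elim (use survives_if_percolates in blast)
  then show ?thesis unfolding percolation_prob_def by (rule prob_eq_0_AE)
qed

lemma supercritical:
  assumes p: "0 \<le> p" "p \<le> 1" and super: "real k * p > 1"
  shows "percolation_prob UNIV E p > 0"
proof -
  interpret prob_space "percolation E p" by (rule prob_space_percolation)
  let ?A = "\<lambda>n. {\<omega> \<in> space (percolation E p). survives n (Suc k) \<omega>}"
  have "(\<lambda>n. prob (?A n)) \<longlonglongrightarrow> prob (\<Inter>n. ?A n)"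
    by (intro finite_Lim_measure_decseq)
      (use survives_event survives_mono in \<open>auto simp: decseq_Suc_iff simp del: survives.simps\<close>)
  moreover have "1 - 1 / (real k * p) \<le> prob (?A n)" for n
    using prob_survives[OF p, of "Suc k" n] survival_prob_ge[OF p super, of n] by simp
  ultimately have "1 - 1 / (real k * p) \<le> prob (\<Inter>n. ?A n)"
    by (intro LIMSEQ_le_const) auto
  also have "\<dots> \<le> percolation_prob UNIV E p"
    unfolding percolation_prob_def
    by (intro finite_measure_mono percolates_measurable simple)
      (auto intro: percolates_if_survives[of "Suc k"])
  moreover have "1 / (real k * p) < 1" using super by simp
  ultimately show ?thesis by linarith
qed

lemma critical_prob_eq: "critical_prob UNIV E = 1 / real k"
  unfolding critical_prob_def
proof (rule cSup_eq_non_empty)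
  have "percolation_prob UNIV E 0 = 0" by (rule subcritical) auto
  then show "{p \<in> {0..1}. percolation_prob UNIV E p = 0} \<noteq> {}"
    by (metis (mono_tags, lifting) atLeastAtMost_iff empty_iff le_numeral_extra(3) mem_Collect_eq zero_le_one)
next
  fix p assume "p \<in> {p \<in> {0..1}. percolation_prob UNIV E p = 0}"
  then have "\<not> real k * p > 1" using supercritical[of p] by auto
  then show "p \<le> 1 / real k" using k2 by (simp add: field_simps)
next
  fix y assume y: "\<And>p. p \<in> {p \<in> {0..1}. percolation_prob UNIV E p = 0} \<Longrightarrow> p \<le> y"
  show "1 / real k \<le> y"
  proof (rule dense_le_bounded[of 0])
    fix p :: real assume p: "0 < p" "p < 1 / real k"
    have "1 / real k \<le> 1" using k2 by simp
    moreover have "real k * p < 1" using p k2 by (simp add: field_simps)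
    ultimately show "p \<le> y" using p by (intro y) (auto intro: subcritical)
  qed (use k2 in simp)
qed

end

theorem mainTheorem2:
  fixes d :: nat
  assumes "d \<ge> 3"
  shows "\<exists>(V :: nat set) (E :: nat set set).
    simple_graph V E \<and> infinite V \<and> connected_graph V E \<and> regular_graph d V E \<and>
    contains_cycle E \<and> \<not> quasi_transitive V E \<and>
    critical_prob V E = 1 / (real d - 1)"
proof -
  interpret unicyclic "d - 1" by standard (use assms in auto)
  have "Suc (d - 1) = d" "real (d - 1) = real d - 1" using assms by auto
  then show ?thesis
    using simple connected regular cycle not_quasi_transitive critical_prob_eq
    by (intro exI[of _ UNIV] exI[of _ E]) (auto simp: contains_cycle_def)
qed

end
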